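(* Every pure double Boolean algebra $\mathbf D$ is isomorphic to the algebra $\mathcal S^T(\mathbb K^T_{pr}(\mathbf D))$ of clopen object oriented semiconcepts of $\mathbb K^T_{pr}(\mathbf D)$.
   Context: A double Boolean algebra (dBa) is an algebra $\mathbf{D}=(D,\sqcup,\sqcap,\neg,\lrcorner,\top,\bot)$ of type $(2,2,1,1,0,0)$ such that, with $x\vee y:=\neg(\neg x\sqcap\neg y)$ and $x\wedge y:=\lrcorner(\lrcorner x\sqcup\lrcorner y)$, for all $x,y,z\in D$: $(x\sqcap x)\sqcap y=x\sqcap y$; $x\sqcap y=y\sqcap x$; $x\sqcap(y\sqcap z)=(x\sqcap y)\sqcap z$; $\neg(x\sqcap x)=\neg x$; $x\sqcap(x\sqcup y)=x\sqcap x$; $x\sqcap(y\vee z)=(x\sqcap y)\vee(x\sqcap z)$; $x\sqcap(x\vee y)=x\sqcap x$; $\neg\neg(x\sqcap y)=x\sqcap y$; $x\sqcap\neg x=\bot$; $\neg\bot=\top\sqcap\top$; $\neg\top=\bot$; the duals $(x\sqcup x)\sqcup y=x\sqcup y$; $x\sqcup y=y\sqcup x$; $x\sqcup(y\sqcup z)=(x\sqcup y)\sqcup z$; $\lrcorner(x\sqcup x)=\lrcorner x$; $x\sqcup(x\sqcap y)=x\sqcup x$; $x\sqcup(y\wedge z)=(x\sqcup y)\wedge(x\sqcup z)$; $x\sqcup(x\wedge y)=x\sqcup x$; $\lrcorner\lrcorner(x\sqcup y)=x\sqcup y$; $x\sqcup\lrcorner x=\top$; $\lrcorner\top=\bot\sqcup\bot$;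 $\lrcorner\bot=\top$; and $(x\sqcap x)\sqcup(x\sqcap x)=(x\sqcup x)\sqcap(x\sqcup x)$. The quasi-order is $x\sqsubseteq y$ iff $x\sqcap y=x\sqcap x$ and $x\sqcup y=y\sqcup y$. $\mathbf D$ is pure if for every $x\in D$, $x\sqcap x=x$ or $x\sqcup x=x$. A dBa isomorphism is a bijection preserving all operations and constants. A filter is $F\subseteq D$ closed under $\sqcap$ and upward closed for $\sqsubseteq$; an ideal is $I\subseteq D$ closed under $\sqcup$ and downward closed. A primary filter is a filter $F\ne D$ with $x\in F$ or $\neg x\in F$ for all $x$; a primary ideal is an ideal $I\ne D$ with $x\in I$ or $\lrcorner x\in I$ for all $x$. $\mathcal F_{pr}(\mathbf D)$, $\mathcal I_{pr}(\mathbf D)$ denote the sets of these; $F_x:=\{F\in\mathcal F_{pr}(\mathbf D):x\in F\}$, $I_x:=\{I\in\mathcal I_{pr}(\mathbf D):x\in I\}$. $\mathcal T$ is the topology on $\mathcal F_{pr}(\mathbf D)$ with subbase of closed sets $\{F_x:x\in D\}$; $\mathcal J$ is the topology on $\mathcal I_{pr}(\mathbf D)$ with subbase of closed sets $\{I_x:x\in D\}$. $\mathbb K^T_{pr}(\mathbf D):=((\mathcal F_{pr}(\mathbf D),\mathcal T),(\mathcal I_{pr}(\mathbf D),\mathcal J),\nabla)$, $F\nabla I$ iff $F\cap I=\emptyset$. For a relation $R\subseteq G\times M$, $A\subseteq G$, $B\subseteq M$: $A^{\blacksquare}:=\{m:R^{-1}(m)\subseteq A\}$, $B^{\lozenge}:=\{g:R(g)\cap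 B\neq\emptyset\}$. An object oriented semiconcept is a pair $(A,B)$ with $A^{\blacksquare}=B$ or $B^{\lozenge}=A$. Operations: $(A,B)\sqcap(C,D)=(A\cup C,(A\cup C)^{\blacksquare})$, $(A,B)\sqcup(C,D)=((B\cap D)^{\lozenge},B\cap D)$, $\neg(A,B)=(A^c,A^{c\blacksquare})$, $\lrcorner(A,B)=(B^{c\lozenge},B^c)$, $\top=(\emptyset,\emptyset)$, $\bot=(G,M)$. For $((G,\rho),(M,\tau),R)$ with topologies, $\mathcal S^T$ is the set of object oriented semiconcepts $(A,B)$ with $A$ clopen in $G$ and $B$ clopen in $M$, with these operations. *)

theory Defs
  imports "HOL-Analysis.Analysis"
begin

text \<open>The complement for \<open>\<sqinter>\<close> is written \<open>\<sim>\<close> and the complement for \<open>\<squnion>\<close> is written \<open>\<ominus>\<close>;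
  the derived operations \<open>\<or>\<close> and \<open>\<and>\<close> are written \<open>\<curlyvee>\<close> and \<open>\<curlywedge>\<close>.\<close>

record 'a dba =
  dcarrier :: "'a set"
  djoin :: "'a \<Rightarrow> 'a \<Rightarrow> 'a" (infixl "\<squnion>\<index>" 65)
  dmeet :: "'a \<Rightarrow> 'a \<Rightarrow> 'a" (infixl "\<sqinter>\<index>" 70)
  dneg :: "'a \<Rightarrow> 'a" ("\<sim>\<index> _" [81] 80)
  dopp :: "'a \<Rightarrow> 'a" ("\<ominus>\<index> _" [81] 80)
  dtop :: 'a ("\<top>\<index>")
  dbot :: 'a ("\<bottom>\<index>")

definition dvee :: "('a, 'm) dba_scheme \<Rightarrow> 'a \<Rightarrow> 'a \<Rightarrow> 'a" (infixl "\<curlyvee>\<index>" 65)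
  where "x \<curlyvee>\<^bsub>D\<^esub> y = \<sim>\<^bsub>D\<^esub> ((\<sim>\<^bsub>D\<^esub> x) \<sqinter>\<^bsub>D\<^esub> (\<sim>\<^bsub>D\<^esub> y))"

definition dwedge :: "('a, 'm) dba_scheme \<Rightarrow> 'a \<Rightarrow> 'a \<Rightarrow> 'a" (infixl "\<curlywedge>\<index>" 70)
  where "x \<curlywedge>\<^bsub>D\<^esub> y = \<ominus>\<^bsub>D\<^esub> ((\<ominus>\<^bsub>D\<^esub> x) \<squnion>\<^bsub>D\<^esub> (\<ominus>\<^bsub>D\<^esub> y))"

locale double_boolean_algebra =
  fixes D (structure)
  assumes join_closed: "\<lbrakk>x \<in> dcarrier D; y \<in> dcarrier D\<rbrakk> \<Longrightarrow> x \<squnion> y \<in> dcarrier D"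
    and meet_closed: "\<lbrakk>x \<in> dcarrier D; y \<in> dcarrier D\<rbrakk> \<Longrightarrow> x \<sqinter> y \<in> dcarrier D"
    and neg_closed: "x \<in> dcarrier D \<Longrightarrow> \<sim> x \<in> dcarrier D"
    and opp_closed: "x \<in> dcarrier D \<Longrightarrow> \<ominus> x \<in> dcarrier D"
    and top_closed: "\<top> \<in> dcarrier D"
    and bot_closed: "\<bottom> \<in> dcarrier D"
    and meet_idem: "\<lbrakk>x \<in> dcarrier D; y \<in> dcarrier D\<rbrakk> \<Longrightarrow> (x \<sqinter> x) \<sqinter> y = x \<sqinter> y"
    and meet_comm: "\<lbrakk>x \<in> dcarrier D; y \<in> dcarrier D\<rbrakk> \<Longrightarrow> x \<sqinter> y = y \<sqinter> x"
    and meet_assoc: "\<lbrakk>x \<in> dcarrier D; y \<in> dcarrier D; z \<in> dcarrier D\<rbrakk>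
          \<Longrightarrow> x \<sqinter> (y \<sqinter> z) = (x \<sqinter> y) \<sqinter> z"
    and neg_meet_self: "x \<in> dcarrier D \<Longrightarrow> \<sim> (x \<sqinter> x) = \<sim> x"
    and meet_join_absorb: "\<lbrakk>x \<in> dcarrier D; y \<in> dcarrier D\<rbrakk> \<Longrightarrow> x \<sqinter> (x \<squnion> y) = x \<sqinter> x"
    and meet_vee_distrib: "\<lbrakk>x \<in> dcarrier D; y \<in> dcarrier D; z \<in> dcarrier D\<rbrakk>
          \<Longrightarrow> x \<sqinter> (y \<curlyvee> z) = (x \<sqinter> y) \<curlyvee> (x \<sqinter> z)"
    and meet_vee_absorb: "\<lbrakk>x \<in> dcarrier D; y \<in> dcarrier D\<rbrakk> \<Longrightarrow> x \<sqinter> (x \<curlyvee> y) = x \<sqinter> x"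
    and neg_neg_meet: "\<lbrakk>x \<in> dcarrier D; y \<in> dcarrier D\<rbrakk> \<Longrightarrow> \<sim> (\<sim> (x \<sqinter> y)) = x \<sqinter> y"
    and meet_neg: "x \<in> dcarrier D \<Longrightarrow> x \<sqinter> (\<sim> x) = \<bottom>"
    and neg_bot: "\<sim> \<bottom> = \<top> \<sqinter> \<top>"
    and neg_top: "\<sim> \<top> = \<bottom>"
    and join_idem: "\<lbrakk>x \<in> dcarrier D; y \<in> dcarrier D\<rbrakk> \<Longrightarrow> (x \<squnion> x) \<squnion> y = x \<squnion> y"
    and join_comm: "\<lbrakk>x \<in> dcarrier D; y \<in> dcarrier D\<rbrakk> \<Longrightarrow> x \<squnion> y = y \<squnion> x"
    and join_assoc: "\<lbrakk>x \<in> dcarrier D; y \<in> dcarrier D; z \<in> dcarrier D\<rbrakk>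
          \<Longrightarrow> x \<squnion> (y \<squnion> z) = (x \<squnion> y) \<squnion> z"
    and opp_join_self: "x \<in> dcarrier D \<Longrightarrow> \<ominus> (x \<squnion> x) = \<ominus> x"
    and join_meet_absorb: "\<lbrakk>x \<in> dcarrier D; y \<in> dcarrier D\<rbrakk> \<Longrightarrow> x \<squnion> (x \<sqinter> y) = x \<squnion> x"
    and join_wedge_distrib: "\<lbrakk>x \<in> dcarrier D; y \<in> dcarrier D; z \<in> dcarrier D\<rbrakk>
          \<Longrightarrow> x \<squnion> (y \<curlywedge> z) = (x \<squnion> y) \<curlywedge> (x \<squnion> z)"
    and join_wedge_absorb: "\<lbrakk>x \<in> dcarrier D; y \<in> dcarrier D\<rbrakk> \<Longrightarrow> x \<squnion> (x \<curlywedge> y) = x \<squnion> x"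
    and opp_opp_join: "\<lbrakk>x \<in> dcarrier D; y \<in> dcarrier D\<rbrakk> \<Longrightarrow> \<ominus> (\<ominus> (x \<squnion> y)) = x \<squnion> y"
    and join_opp: "x \<in> dcarrier D \<Longrightarrow> x \<squnion> (\<ominus> x) = \<top>"
    and opp_top: "\<ominus> \<top> = \<bottom> \<squnion> \<bottom>"
    and opp_bot: "\<ominus> \<bottom> = \<top>"
    and meet_join_self: "x \<in> dcarrier D \<Longrightarrow> (x \<sqinter> x) \<squnion> (x \<sqinter> x) = (x \<squnion> x) \<sqinter> (x \<squnion> x)"

locale pure_double_boolean_algebra = double_boolean_algebra +
  assumes pure: "x \<in> dcarrier D \<Longrightarrow> x \<sqinter> x = x \<or> x \<squnion> x = x"

definition dle :: "('a, 'm) dba_scheme \<Rightarrow> 'a \<Rightarrow> 'a \<Rightarrow> bool" (infix "\<sqsubseteq>\<index>" 50)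
  where "x \<sqsubseteq>\<^bsub>D\<^esub> y \<longleftrightarrow> x \<sqinter>\<^bsub>D\<^esub> y = x \<sqinter>\<^bsub>D\<^esub> x \<and> x \<squnion>\<^bsub>D\<^esub> y = y \<squnion>\<^bsub>D\<^esub> y"

definition dba_iso :: "('a, 'm) dba_scheme \<Rightarrow> ('b, 'n) dba_scheme \<Rightarrow> ('a \<Rightarrow> 'b) \<Rightarrow> bool"
  where "dba_iso D E h \<longleftrightarrow>
    bij_betw h (dcarrier D) (dcarrier E) \<and>
    (\<forall>x\<in>dcarrier D. \<forall>y\<in>dcarrier D. h (x \<squnion>\<^bsub>D\<^esub> y) = h x \<squnion>\<^bsub>E\<^esub> h y) \<and>
    (\<forall>x\<in>dcarrier D. \<forall>y\<in>dcarrier D. h (x \<sqinter>\<^bsub>D\<^esub> y) = h x \<sqinter>\<^bsub>E\<^esub> h y) \<and>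
    (\<forall>x\<in>dcarrier D. h (\<sim>\<^bsub>D\<^esub> x) = \<sim>\<^bsub>E\<^esub> (h x)) \<and>
    (\<forall>x\<in>dcarrier D. h (\<ominus>\<^bsub>D\<^esub> x) = \<ominus>\<^bsub>E\<^esub> (h x)) \<and>
    h \<top>\<^bsub>D\<^esub> = \<top>\<^bsub>E\<^esub> \<and>
    h \<bottom>\<^bsub>D\<^esub> = \<bottom>\<^bsub>E\<^esub>"

definition dba_isomorphic :: "('a, 'm) dba_scheme \<Rightarrow> ('b, 'n) dba_scheme \<Rightarrow> bool"
  where "dba_isomorphic D E \<longleftrightarrow> (\<exists>h. dba_iso D E h)"

definition dba_filter :: "('a, 'm) dba_scheme \<Rightarrow> 'a set \<Rightarrow> bool"
  where "dba_filter D F \<longleftrightarrow> F \<subseteq> dcarrier D \<and>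
    (\<forall>x\<in>F. \<forall>y\<in>F. x \<sqinter>\<^bsub>D\<^esub> y \<in> F) \<and>
    (\<forall>x\<in>F. \<forall>y\<in>dcarrier D. x \<sqsubseteq>\<^bsub>D\<^esub> y \<longrightarrow> y \<in> F)"

definition dba_ideal :: "('a, 'm) dba_scheme \<Rightarrow> 'a set \<Rightarrow> bool"
  where "dba_ideal D I \<longleftrightarrow> I \<subseteq> dcarrier D \<and>
    (\<forall>x\<in>I. \<forall>y\<in>I. x \<squnion>\<^bsub>D\<^esub> y \<in> I) \<and>
    (\<forall>x\<in>I. \<forall>y\<in>dcarrier D. y \<sqsubseteq>\<^bsub>D\<^esub> x \<longrightarrow> y \<in> I)"

definition primary_filters :: "('a, 'm) dba_scheme \<Rightarrow> 'a set set"
  where "primary_filters D =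
    {F. dba_filter D F \<and> F \<noteq> dcarrier D \<and> (\<forall>x\<in>dcarrier D. x \<in> F \<or> \<sim>\<^bsub>D\<^esub> x \<in> F)}"

definition primary_ideals :: "('a, 'm) dba_scheme \<Rightarrow> 'a set set"
  where "primary_ideals D =
    {I. dba_ideal D I \<and> I \<noteq> dcarrier D \<and> (\<forall>x\<in>dcarrier D. x \<in> I \<or> \<ominus>\<^bsub>D\<^esub> x \<in> I)}"

definition primary_filters_at :: "('a, 'm) dba_scheme \<Rightarrow> 'a \<Rightarrow> 'a set set"
  where "primary_filters_at D x = {F \<in> primary_filters D. x \<in> F}"

definition primary_ideals_at :: "('a, 'm) dba_scheme \<Rightarrow> 'a \<Rightarrow> 'a set set"
  where "primary_ideals_at D x = {I \<in> primary_ideals D. x \<in> I}"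

text \<open>The topology on \<open>X\<close> whose open sets are the unions of finite intersections of sets
  \<open>X - C\<close> with \<open>C \<in> \<C>\<close>, the empty intersection being \<open>X\<close>.\<close>

definition closed_subbase_topology :: "'a set \<Rightarrow> 'a set set \<Rightarrow> 'a topology"
  where "closed_subbase_topology X \<C> =
    topology (arbitrary union_of (finite intersection_of (\<lambda>U. \<exists>C\<in>\<C>. U = X - C) relative_to X))"

record ('g, 'm) topological_context =
  objects :: "'g topology"
  attributes :: "'m topology"
  incidence :: "('g \<times> 'm) set"

definition primary_context ::
    "('a, 'm) dba_scheme \<Rightarrow> ('a set, 'a set) topological_context"
  where "primary_context D = \<lparr>
    objects = closed_subbase_topology (primary_filters D) (primary_filters_at D ` dcarrier D),
    attributes = closed_subbase_topology (primary_ideals D) (primary_ideals_at D ` dcarrier D),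
    incidence = {(F, I). F \<in> primary_filters D \<and> I \<in> primary_ideals D \<and> F \<inter> I = {}}\<rparr>"

definition oo_box :: "'m set \<Rightarrow> ('g \<times> 'm) set \<Rightarrow> 'g set \<Rightarrow> 'm set"
  where "oo_box M R A = {m \<in> M. R\<inverse> `` {m} \<subseteq> A}"

definition oo_diamond :: "'g set \<Rightarrow> ('g \<times> 'm) set \<Rightarrow> 'm set \<Rightarrow> 'g set"
  where "oo_diamond G R B = {g \<in> G. R `` {g} \<inter> B \<noteq> {}}"

definition oo_semiconcepts ::
    "'g set \<Rightarrow> 'm set \<Rightarrow> ('g \<times> 'm) set \<Rightarrow> ('g set \<times> 'm set) set"
  where "oo_semiconcepts G M R =
    {(A, B). A \<subseteq> G \<and> B \<subseteq> M \<and> (oo_box M R A = B \<or> oo_diamond G R B = A)}"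

definition clopen_oo_semiconcept_algebra ::
    "('g, 'm) topological_context \<Rightarrow> ('g set \<times> 'm set) dba"
  where "clopen_oo_semiconcept_algebra K =
    (let G = topspace (objects K); M = topspace (attributes K); R = incidence K in \<lparr>
      dcarrier = {(A, B) \<in> oo_semiconcepts G M R.
        openin (objects K) A \<and> closedin (objects K) A \<and>
        openin (attributes K) B \<and> closedin (attributes K) B},
      djoin = (\<lambda>(A, B) (C, D). (oo_diamond G R (B \<inter> D), B \<inter> D)),
      dmeet = (\<lambda>(A, B) (C, D). (A \<union> C, oo_box M R (A \<union> C))),
      dneg = (\<lambda>(A, B). (G - A, oo_box M R (G - A))),
      dopp = (\<lambda>(A, B). (oo_diamond G R (M - B), M - B)),
      dtop = ({}, {}),
      dbot = (G, M)\<rparr>)"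

end

theory Submission imports Defs begin

text \<open>The isomorphism sends \<open>x\<close> to the pair of the primary filters omitting \<open>x\<close> and the primary
  ideals containing \<open>x\<close>. Zorn's lemma separates a \<open>\<sqinter>\<close>-idempotent from an ideal by a primary
  filter, hence the second component is the box of the first for \<open>\<sqinter>\<close>-idempotents; dually the first
  is the diamond of the second for \<open>\<squnion>\<close>-idempotents, and purity leaves no other elements. Compactness
  of the two spaces makes every clopen set a basic one, which gives surjectivity. Everything about
  ideals is obtained from filters of the dual algebra.\<close>

section \<open>The dual algebra\<close>

definition dba_dual :: "('a, 'm) dba_scheme \<Rightarrow> 'a dba"
  where "dba_dual D = \<lparr>dcarrier = dcarrier D, djoin = dmeet D, dmeet = djoin D,
    dneg = dopp D, dopp = dneg D, dtop = dbot D, dbot = dtop D\<rparr>"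

lemma dba_dual_simps [simp]:
  "dcarrier (dba_dual D) = dcarrier D"
  "djoin (dba_dual D) = dmeet D"
  "dmeet (dba_dual D) = djoin D"
  "dneg (dba_dual D) = dopp D"
  "dopp (dba_dual D) = dneg D"
  "dtop (dba_dual D) = dbot D"
  "dbot (dba_dual D) = dtop D"
  by (simp_all add: dba_dual_def)

lemma dvee_dba_dual [simp]: "dvee (dba_dual D) = dwedge D"
  by (simp add: fun_eq_iff dvee_def dwedge_def)

lemma dwedge_dba_dual [simp]: "dwedge (dba_dual D) = dvee D"
  by (simp add: fun_eq_iff dvee_def dwedge_def)

text \<open>The two conjuncts of \<open>\<sqsubseteq>\<close> trade places; commutativity of both
  operations turns \<open>x\<close> and \<open>y\<close> around.\<close>

lemma dle_dba_dual:
  assumes "double_boolean_algebra D" "x \<in> dcarrier D" "y \<in> dcarrier D"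
  shows "dle (dba_dual D) x y \<longleftrightarrow> dle D y x"
  using assms double_boolean_algebra.join_comm[of D x y] double_boolean_algebra.meet_comm[of D x y]
  by (auto simp: dle_def)

lemma dba_filter_dba_dual:
  assumes "double_boolean_algebra D"
  shows "dba_filter (dba_dual D) = dba_ideal D"
  using dle_dba_dual[OF assms] by (fastforce simp: fun_eq_iff dba_filter_def dba_ideal_def)

lemma primary_filters_dba_dual:
  assumes "double_boolean_algebra D"
  shows "primary_filters (dba_dual D) = primary_ideals D"
  by (simp add: primary_filters_def primary_ideals_def dba_filter_dba_dual[OF assms])

lemma primary_filters_at_dba_dual:
  assumes "double_boolean_algebra D"
  shows "primary_filters_at (dba_dual D) = primary_ideals_at D"
  by (simp add: fun_eq_iff primary_filters_at_def primary_ideals_at_def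
      primary_filters_dba_dual[OF assms])

lemma primary_filters_at_subset: "primary_filters_at D x \<subseteq> primary_filters D"
  by (auto simp: primary_filters_at_def)

section \<open>Topologies with a subbase of closed sets\<close>

lemma topspace_closed_subbase_topology [simp]:
  "topspace (closed_subbase_topology X \<C>) = X"
  unfolding closed_subbase_topology_def by (rule topspace_subbase)

lemma openin_closed_subbase_topology:
  "openin (closed_subbase_topology X \<C>) =
    (arbitrary union_of (finite intersection_of (\<lambda>U. \<exists>C\<in>\<C>. U = X - C) relative_to X))"
  unfolding closed_subbase_topology_def by (simp add: istopology_subbase)

lemma closedin_closed_subbase_topology:
  assumes "C \<in> \<C>" "C \<subseteq> X"
  shows "closedin (closed_subbase_topology X \<C>) C"
proof -
  have "(finite intersection_of (\<lambda>U. \<exists>C\<in>\<C>. U = X - C) relative_to X) (X \<inter> (X - C))"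
    using assms by (intro relative_to_inc finite_intersection_of_inc) auto
  then have "openin (closed_subbase_topology X \<C>) (X \<inter> (X - C))"
    unfolding openin_closed_subbase_topology by (rule arbitrary_union_of_inc)
  moreover have "X \<inter> (X - C) = X - C" by blast
  ultimately show ?thesis using assms by (simp add: closedin_def)
qed

section \<open>Arithmetic of double Boolean algebras\<close>

context double_boolean_algebra
begin

lemma dual_dba: "double_boolean_algebra (dba_dual D)"
  \<comment> \<open>Every axiom has its dual among the axioms. The last one is self-dual with its
    sides exchanged, hence \<open>symmetric\<close>.\<close>
  by (unfold_locales, unfold dba_dual_simps dvee_dba_dual dwedge_dba_dual)
    (rule join_closed meet_closed neg_closed opp_closed top_closed bot_closed
      meet_idem meet_comm meet_assoc neg_meet_self meet_join_absorb meet_vee_distrib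
      meet_vee_absorb neg_neg_meet meet_neg neg_bot neg_top join_idem join_comm join_assoc
      opp_join_self join_meet_absorb join_wedge_distrib join_wedge_absorb opp_opp_join join_opp
      opp_top opp_bot meet_join_self[symmetric]; assumption)+

lemmas closed [simp] =
  join_closed meet_closed neg_closed opp_closed top_closed bot_closed

lemma vee_closed [simp]:
  "\<lbrakk>x \<in> dcarrier D; y \<in> dcarrier D\<rbrakk> \<Longrightarrow> x \<curlyvee> y \<in> dcarrier D"
  by (simp add: dvee_def)

lemma meet_left_comm:
  "\<lbrakk>x \<in> dcarrier D; y \<in> dcarrier D; z \<in> dcarrier D\<rbrakk> \<Longrightarrow> x \<sqinter> (y \<sqinter> z) = y \<sqinter> (x \<sqinter> z)"
  by (metis meet_assoc meet_comm)

lemma meet_left_idem: "\<lbrakk>x \<in> dcarrier D; y \<in> dcarrier D\<rbrakk> \<Longrightarrow> x \<sqinter> (x \<sqinter> y) = x \<sqinter> y"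
  by (metis meet_assoc meet_idem)

lemma meet_right_idem: "\<lbrakk>x \<in> dcarrier D; y \<in> dcarrier D\<rbrakk> \<Longrightarrow> x \<sqinter> (y \<sqinter> y) = x \<sqinter> y"
  by (metis meet_comm meet_idem meet_closed)

text \<open>Since \<open>x \<sqinter> x\<close> need not be \<open>x\<close>, a repeated factor may
  be dropped only while two factors remain; the two idempotence rules respect this.\<close>

lemmas meet_ac = meet_assoc[symmetric] meet_comm meet_left_comm meet_left_idem meet_right_idem

lemma meet_self_meet:
  "\<lbrakk>x \<in> dcarrier D; y \<in> dcarrier D\<rbrakk> \<Longrightarrow> (x \<sqinter> y) \<sqinter> (x \<sqinter> y) = x \<sqinter> y"
  by (simp add: meet_ac)

lemma neg_neg: "x \<in> dcarrier D \<Longrightarrow> \<sim> (\<sim> x) = x \<sqinter> x"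
  by (metis neg_meet_self neg_neg_meet)

lemma meet_self_neg: "x \<in> dcarrier D \<Longrightarrow> \<sim> x \<sqinter> \<sim> x = \<sim> x"
  by (metis neg_closed neg_meet_self neg_neg)

lemma le_refl: "x \<in> dcarrier D \<Longrightarrow> x \<sqsubseteq> x"
  by (simp add: dle_def)

text \<open>This is the \<open>\<sqinter>\<close>-half of transitivity of
  \<open>\<sqsubseteq>\<close>; the \<open>\<squnion>\<close>-half is the same fact in the dual
  algebra, for the reversed chain.\<close>

lemma meet_absorb_trans:
  assumes "x \<in> dcarrier D" "y \<in> dcarrier D" "z \<in> dcarrier D"
    "x \<sqinter> y = x \<sqinter> x" "y \<sqinter> z = y \<sqinter> y"
  shows "x \<sqinter> z = x \<sqinter> x"
proof -
  have "x \<sqinter> z = (x \<sqinter> y) \<sqinter> z" using assms by (metis meet_idem)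
  also have "\<dots> = x \<sqinter> (y \<sqinter> y)" using assms by (metis meet_assoc)
  finally show ?thesis using assms by (simp add: meet_right_idem)
qed

lemma le_trans:
  assumes "x \<in> dcarrier D" "y \<in> dcarrier D" "z \<in> dcarrier D" "x \<sqsubseteq> y" "y \<sqsubseteq> z"
  shows "x \<sqsubseteq> z"
proof -
  have "x \<sqinter> z = x \<sqinter> x"
    using meet_absorb_trans[of x y z] assms by (simp add: dle_def)
  moreover have "z \<squnion> x = z \<squnion> z"
    using double_boolean_algebra.meet_absorb_trans[OF dual_dba, of z y x] assms
    by (simp add: dle_def join_comm)
  ultimately show ?thesis using assms by (simp add: dle_def join_comm)
qed

text \<open>Below a \<open>\<sqinter>\<close>-idempotent left-hand side the
  \<open>\<squnion>\<close>-half of \<open>\<sqsubseteq>\<close> comes for free: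
  \<open>x \<sqinter> x\<close> equals \<open>y \<sqinter> x\<close>, and
  \<open>y \<squnion> (y \<sqinter> x) = y \<squnion> y\<close>. Inequalities between meets thus
  reduce to one equation.\<close>

lemma meet_self_le:
  assumes "x \<in> dcarrier D" "y \<in> dcarrier D" "x \<sqinter> y = x \<sqinter> x"
  shows "x \<sqinter> x \<sqsubseteq> y"
proof -
  have "(x \<sqinter> x) \<squnion> y = y \<squnion> y"
    using assms by (metis join_comm join_meet_absorb meet_closed meet_comm)
  then show ?thesis using assms by (simp add: dle_def meet_idem meet_right_idem)
qed

lemma meet_le1: "\<lbrakk>x \<in> dcarrier D; y \<in> dcarrier D\<rbrakk> \<Longrightarrow> x \<sqinter> y \<sqsubseteq> x"
  using meet_self_le[of "x \<sqinter> y" x] by (simp add: meet_ac)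

lemma meet_le2: "\<lbrakk>x \<in> dcarrier D; y \<in> dcarrier D\<rbrakk> \<Longrightarrow> x \<sqinter> y \<sqsubseteq> y"
  using meet_le1[of y x] by (simp add: meet_comm)

lemma le_meetI:
  assumes "x \<in> dcarrier D" "y \<in> dcarrier D" "z \<in> dcarrier D" "z \<sqinter> z = z" "z \<sqsubseteq> x" "z \<sqsubseteq> y"
  shows "z \<sqsubseteq> x \<sqinter> y"
proof -
  have "z \<sqinter> (x \<sqinter> y) = z \<sqinter> z" using assms by (simp add: dle_def meet_assoc)
  then show ?thesis using meet_self_le[of z "x \<sqinter> y"] assms by simp
qed

lemma bot_meet_self: "\<bottom> \<sqinter> \<bottom> = \<bottom>"
  by (metis bot_closed meet_neg meet_self_meet neg_closed)

lemma bot_le: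
  assumes "x \<in> dcarrier D"
  shows "\<bottom> \<sqsubseteq> x"
  using meet_le1[of x "\<sim> x"] assms by (simp add: meet_neg)

lemma le_top:
  assumes "x \<in> dcarrier D"
  shows "x \<sqsubseteq> \<top>"
  using double_boolean_algebra.bot_le[OF dual_dba, of x] assms
    dle_dba_dual[OF double_boolean_algebra_axioms, of \<top> x] by simp

lemma meet_vee_neg:
  assumes "x \<in> dcarrier D" "y \<in> dcarrier D"
  shows "x \<sqinter> (y \<curlyvee> \<sim> y) = x \<sqinter> x"
proof -
  have "y \<curlyvee> \<sim> y = \<top> \<sqinter> \<top>" using assms by (simp add: dvee_def meet_neg neg_bot)
  then show ?thesis using le_top[of x] assms by (simp add: meet_right_idem dle_def)
qed

text \<open>Distributing \<open>x \<squnion> y\<close> over \<open>x \<curlyvee> y\<close> and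
  absorbing leaves the squares of \<open>x\<close> and \<open>y\<close>, whose vee is
  \<open>x \<curlyvee> y\<close>. The use is that an ideal, closed under \<open>\<squnion>\<close>
  and downwards, is also closed under \<open>\<curlyvee>\<close>.\<close>

lemma vee_le_join:
  assumes "x \<in> dcarrier D" "y \<in> dcarrier D"
  shows "x \<curlyvee> y \<sqsubseteq> x \<squnion> y"
proof -
  have "(x \<squnion> y) \<sqinter> (x \<curlyvee> y) = ((x \<squnion> y) \<sqinter> x) \<curlyvee> ((x \<squnion> y) \<sqinter> y)"
    using assms by (simp add: meet_vee_distrib)
  also have "(x \<squnion> y) \<sqinter> x = x \<sqinter> x" using assms by (metis meet_comm meet_join_absorb join_closed)
  also have "(x \<squnion> y) \<sqinter> y = y \<sqinter> y"
    using assms by (metis meet_comm meet_join_absorb join_closed join_comm)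
  also have "(x \<sqinter> x) \<curlyvee> (y \<sqinter> y) = x \<curlyvee> y" using assms by (simp add: dvee_def neg_meet_self)
  finally have *: "(x \<curlyvee> y) \<sqinter> (x \<squnion> y) = x \<curlyvee> y" using assms by (simp add: meet_comm)
  have **: "(x \<curlyvee> y) \<sqinter> (x \<curlyvee> y) = x \<curlyvee> y" using assms by (simp add: dvee_def meet_self_neg)
  then show ?thesis using meet_self_le[of "x \<curlyvee> y" "x \<squnion> y"] * assms by simp
qed

text \<open>A Boolean case distinction: \<open>x \<sqinter> x\<close> is the vee of
  \<open>x \<sqinter> y\<close> and \<open>x \<sqinter> \<sim> y\<close>, and the latter is
  \<open>\<bottom>\<close>, which is neutral for \<open>\<curlyvee>\<close> on
  \<open>\<sqinter>\<close>-idempotents.\<close>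

lemma meet_neg_eq_bot_imp_meet_absorb:
  assumes "x \<in> dcarrier D" "y \<in> dcarrier D" "x \<sqinter> \<sim> y = \<bottom>"
  shows "x \<sqinter> y = x \<sqinter> x"
proof -
  have "x \<sqinter> x = (x \<sqinter> y) \<curlyvee> \<bottom>"
    using meet_vee_neg[of x y] assms by (simp add: meet_vee_distrib)
  also have "\<dots> = \<sim> (\<sim> (x \<sqinter> y) \<sqinter> (\<top> \<sqinter> \<top>))"
    by (simp add: dvee_def neg_bot)
  also have "\<sim> (x \<sqinter> y) \<sqinter> (\<top> \<sqinter> \<top>) = \<sim> (x \<sqinter> y)"
    using assms le_top[of "\<sim> (x \<sqinter> y)"] by (simp add: meet_right_idem dle_def meet_self_neg)
  finally show ?thesis using assms by (simp add: neg_neg_meet)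
qed

section \<open>Existence of primary filters and separation\<close>

lemma filter_generated:
  assumes F: "dba_filter D F" and x: "x \<in> dcarrier D"
  shows "dba_filter D {y \<in> dcarrier D. \<exists>g\<in>F. g \<sqinter> x \<sqsubseteq> y}"
  unfolding dba_filter_def
proof (intro conjI ballI impI)
  fix y z assume "y \<in> {y \<in> dcarrier D. \<exists>g\<in>F. g \<sqinter> x \<sqsubseteq> y}" "z \<in> {y \<in> dcarrier D. \<exists>g\<in>F. g \<sqinter> x \<sqsubseteq> y}"
  then obtain g h where gh: "y \<in> dcarrier D" "z \<in> dcarrier D" "g \<in> F" "h \<in> F"
    "g \<sqinter> x \<sqsubseteq> y" "h \<sqinter> x \<sqsubseteq> z" by blast
  then have C: "g \<in> dcarrier D" "h \<in> dcarrier D" and "g \<sqinter> h \<in> F"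
    using F by (auto simp: dba_filter_def)
  let ?w = "(g \<sqinter> h) \<sqinter> x"
  \<comment> \<open>The second copy of \<open>x\<close> is absorbed, so the common lower bound of
    \<open>y\<close> and \<open>z\<close> again has the form of an element of \<open>F\<close> met
    with \<open>x\<close>.\<close>
  have "?w = (g \<sqinter> x) \<sqinter> (h \<sqinter> x)" using C x by (simp add: meet_ac)
  then have "?w \<sqsubseteq> g \<sqinter> x" "?w \<sqsubseteq> h \<sqinter> x"
    using C x meet_le1[of "g \<sqinter> x" "h \<sqinter> x"] meet_le2[of "g \<sqinter> x" "h \<sqinter> x"] by auto
  then have "?w \<sqsubseteq> y" "?w \<sqsubseteq> z"
    using gh C x le_trans[of ?w "g \<sqinter> x" y] le_trans[of ?w "h \<sqinter> x" z] by auto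
  then have "?w \<sqsubseteq> y \<sqinter> z" using gh C x by (intro le_meetI) (auto simp: meet_self_meet)
  then show "y \<sqinter> z \<in> {y \<in> dcarrier D. \<exists>g\<in>F. g \<sqinter> x \<sqsubseteq> y}"
    using gh \<open>g \<sqinter> h \<in> F\<close> meet_closed by blast
next
  fix y z assume "y \<in> {y \<in> dcarrier D. \<exists>g\<in>F. g \<sqinter> x \<sqsubseteq> y}" "z \<in> dcarrier D" "y \<sqsubseteq> z"
  then show "z \<in> {y \<in> dcarrier D. \<exists>g\<in>F. g \<sqinter> x \<sqsubseteq> y}"
    using F x le_trans[of _ y z] meet_closed unfolding dba_filter_def by blast
qed auto

lemma principal_filter:
  assumes "x \<in> dcarrier D" "x \<sqinter> x = x"
  shows "dba_filter D {y \<in> dcarrier D. x \<sqsubseteq> y}"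
  unfolding dba_filter_def
proof (intro conjI ballI impI)
  fix y z assume "y \<in> {y \<in> dcarrier D. x \<sqsubseteq> y}" "z \<in> {y \<in> dcarrier D. x \<sqsubseteq> y}"
  then show "y \<sqinter> z \<in> {y \<in> dcarrier D. x \<sqsubseteq> y}" using assms le_meetI[of y z x] by simp
next
  fix y z assume "y \<in> {y \<in> dcarrier D. x \<sqsubseteq> y}" "z \<in> dcarrier D" "y \<sqsubseteq> z"
  then show "z \<in> {y \<in> dcarrier D. x \<sqsubseteq> y}" using assms le_trans[of x y z] by simp
qed auto

text \<open>The set \<open>I\<close> is only required to be an ideal of the Boolean algebra of
  \<open>\<sqinter>\<close>-idempotents: an ideal for \<open>\<squnion>\<close> would be too restrictive, since the one generated by
  \<open>\<bottom>\<close> contains \<open>\<bottom> \<squnion> \<bottom>\<close>, which need not equal \<open>\<bottom>\<close>.\<close>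

lemma primary_filter_extension:
  assumes F: "dba_filter D F" "F \<noteq> {}" and I: "I \<subseteq> dcarrier D" "I \<noteq> {}"
    and down: "\<And>x y. \<lbrakk>x \<in> I; y \<in> dcarrier D; y \<sqsubseteq> x\<rbrakk> \<Longrightarrow> y \<in> I"
    and vee: "\<And>x y. \<lbrakk>x \<in> I; y \<in> I\<rbrakk> \<Longrightarrow> x \<curlyvee> y \<in> I"
    and disj: "F \<inter> I = {}"
  obtains G where "G \<in> primary_filters D" "F \<subseteq> G" "G \<inter> I = {}"
proof -
  let ?A = "{G. dba_filter D G \<and> F \<subseteq> G \<and> G \<inter> I = {}}"
  have "\<exists>G\<in>?A. \<forall>X\<in>?A. G \<subseteq> X \<longrightarrow> X = G"
  proof (rule subset_Zorn_nonempty)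
    show "?A \<noteq> {}" using F disj by blast
    fix \<C> assume ne: "\<C> \<noteq> {}" and ch: "subset.chain ?A \<C>"
    then have sub: "\<And>X. X \<in> \<C> \<Longrightarrow> dba_filter D X \<and> F \<subseteq> X \<and> X \<inter> I = {}"
      by (auto simp: subset.chain_def)
    have "dba_filter D (\<Union>\<C>)"
      unfolding dba_filter_def
    proof (intro conjI ballI impI)
      fix x y assume "x \<in> \<Union>\<C>" "y \<in> \<Union>\<C>"
      then obtain X Y where XY: "X \<in> \<C>" "x \<in> X" "Y \<in> \<C>" "y \<in> Y" by blast
      then have "X \<subseteq> Y \<or> Y \<subseteq> X" using ch by (simp add: subset_chain_def)
      then obtain Z where "Z \<in> \<C>" "x \<in> Z" "y \<in> Z" using XY by blast
      then show "x \<sqinter> y \<in> \<Union>\<C>" using sub unfolding dba_filter_def by blast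
    next
      show "\<Union>\<C> \<subseteq> dcarrier D" using sub unfolding dba_filter_def by blast
    next
      fix x y assume "x \<in> \<Union>\<C>" "y \<in> dcarrier D" "x \<sqsubseteq> y"
      then show "y \<in> \<Union>\<C>" using sub unfolding dba_filter_def by blast
    qed
    then show "\<Union>\<C> \<in> ?A" using sub ne by blast
  qed
  then obtain G where "G \<in> ?A" and max: "\<forall>X\<in>?A. G \<subseteq> X \<longrightarrow> X = G" by (rule bexE)
  then have G: "dba_filter D G" "F \<subseteq> G" "G \<inter> I = {}" by simp_all
  have GC: "G \<subseteq> dcarrier D" using G by (simp add: dba_filter_def)
  \<comment> \<open>The filter generated by \<open>G\<close> and \<open>x\<close> properly extends
    \<open>G\<close>, so by maximality it meets \<open>I\<close>; downward closure of
    \<open>I\<close> carries the common element down to some \<open>g \<sqinter> x\<close>.\<close>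
  have meets: "\<exists>g\<in>G. g \<sqinter> x \<in> I" if x: "x \<in> dcarrier D" "x \<notin> G" for x
  proof -
    let ?X = "{y \<in> dcarrier D. \<exists>g\<in>G. g \<sqinter> x \<sqsubseteq> y}"
    have "G \<subseteq> ?X" using GC x meet_le1 by blast
    moreover have "x \<in> ?X" using F G GC x meet_le2 by blast
    ultimately have "?X \<notin> ?A" using max x by blast
    then have "?X \<inter> I \<noteq> {}"
      using filter_generated[OF G(1) x(1)] \<open>G \<subseteq> ?X\<close> G(2) by simp
    then obtain y g where "y \<in> I" "g \<in> G" "g \<sqinter> x \<sqsubseteq> y" by blast
    moreover from this have "g \<sqinter> x \<in> dcarrier D" using GC x by auto
    ultimately show ?thesis using down[of y "g \<sqinter> x"] by blast
  qed
  have "x \<in> G \<or> \<sim> x \<in> G" if x: "x \<in> dcarrier D" for x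
  proof (rule ccontr)
    assume "\<not> ?thesis"
    then obtain g h where gh: "g \<in> G" "h \<in> G" "g \<sqinter> x \<in> I" "h \<sqinter> \<sim> x \<in> I"
      using meets[OF x] meets[of "\<sim> x"] x by auto
    \<comment> \<open>One element of \<open>G\<close> serves both \<open>x\<close> and
      \<open>\<sim> x\<close>. It is the vee of its parts \<open>?k \<sqinter> x\<close> and
      \<open>?k \<sqinter> \<sim> x\<close>, both in \<open>I\<close>, so it would lie in
      \<open>G \<inter> I\<close>.\<close>
    let ?k = "g \<sqinter> h"
    have C: "g \<in> dcarrier D" "h \<in> dcarrier D" using gh GC by auto
    have "?k \<sqinter> x \<sqsubseteq> g \<sqinter> x"
      using C x meet_le1[of "g \<sqinter> x" h] by (simp add: meet_ac)
    moreover have "?k \<sqinter> \<sim> x \<sqsubseteq> h \<sqinter> \<sim> x"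
      using C x meet_le2[of g "h \<sqinter> \<sim> x"] by (simp add: meet_assoc)
    ultimately have "(?k \<sqinter> x) \<curlyvee> (?k \<sqinter> \<sim> x) \<in> I"
      using vee[OF down[OF gh(3)] down[OF gh(4)]] C x by simp
    moreover have "(?k \<sqinter> x) \<curlyvee> (?k \<sqinter> \<sim> x) = ?k"
      using C x meet_vee_distrib[of ?k x "\<sim> x"] by (simp add: meet_vee_neg meet_self_meet)
    moreover have "?k \<in> G" using G gh by (auto simp: dba_filter_def)
    ultimately show False using G by auto
  qed
  \<comment> \<open>\<open>G\<close> is proper because it misses the nonempty set
    \<open>I\<close>.\<close>
  then have "G \<in> primary_filters D" using G I by (auto simp: primary_filters_def)
  then show thesis using G that by blast
qed

text \<open>The extension lemma is applied with all elements whose \<open>\<sqinter>\<close>-square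
  is \<open>\<bottom>\<close>. This set is closed downwards although \<open>\<sqsubseteq>\<close> is
  only a quasi-order, and \<open>F\<close> misses it because \<open>F\<close> contains the squares
  of its elements.\<close>

lemma primary_filter_avoiding_bot:
  assumes F: "dba_filter D F" "F \<noteq> {}" "\<bottom> \<notin> F"
  obtains G where "G \<in> primary_filters D" "F \<subseteq> G"
proof -
  let ?I = "{x \<in> dcarrier D. x \<sqinter> x = \<bottom>}"
  have "F \<inter> ?I = {}" using F by (force simp: dba_filter_def)
  moreover have "?I \<noteq> {}" using bot_meet_self bot_closed
    by (metis (mono_tags) empty_iff mem_Collect_eq)
  moreover have "y \<in> ?I" if "x \<in> ?I" "y \<in> dcarrier D" "y \<sqsubseteq> x" for x y
  proof -
    have "y \<sqinter> y = y \<sqinter> (x \<sqinter> x)"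
      using that meet_right_idem[of y x] by (simp add: dle_def del: mem_Collect_eq) simp
    also have "\<dots> = \<bottom>" using that bot_le[of y] by (simp add: dle_def meet_comm bot_meet_self)
    finally show ?thesis using that by simp
  qed
  moreover have "x \<curlyvee> y \<in> ?I" if "x \<in> ?I" "y \<in> ?I" for x y
  proof -
    have "\<sim> x = \<sim> \<bottom>" "\<sim> y = \<sim> \<bottom>" using that neg_meet_self by force+
    then have "x \<curlyvee> y = \<bottom>" by (simp add: dvee_def meet_self_neg neg_neg bot_meet_self)
    then show ?thesis by (simp add: bot_meet_self)
  qed
  ultimately show thesis
    using primary_filter_extension[OF F(1,2), of ?I] that
    by (metis (no_types, lifting) mem_Collect_eq subsetI)
qed

text \<open>Idempotence of \<open>x\<close> makes its up-set a filter, and that filter misses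
  \<open>I\<close> because \<open>I\<close> is closed downwards. Closure of \<open>I\<close> under
  \<open>\<curlyvee>\<close> comes from \<open>vee_le_join\<close>.\<close>

lemma primary_filter_separation:
  assumes I: "dba_ideal D I" "I \<noteq> {}" and x: "x \<in> dcarrier D" "x \<sqinter> x = x" "x \<notin> I"
  obtains G where "G \<in> primary_filters D" "x \<in> G" "G \<inter> I = {}"
proof -
  have down: "y \<in> I" if "z \<in> I" "y \<in> dcarrier D" "y \<sqsubseteq> z" for y z
    using I that by (auto simp: dba_ideal_def)
  have vee: "y \<curlyvee> z \<in> I" if "y \<in> I" "z \<in> I" for y z
  proof -
    have "y \<in> dcarrier D" "z \<in> dcarrier D" "y \<squnion> z \<in> I" using I that by (auto simp: dba_ideal_def)
    then show ?thesis using down[of "y \<squnion> z" "y \<curlyvee> z"] vee_le_join[of y z] by simp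
  qed
  have disj: "{y \<in> dcarrier D. x \<sqsubseteq> y} \<inter> I = {}" using down x by blast
  have mem: "x \<in> {y \<in> dcarrier D. x \<sqsubseteq> y}" using x le_refl by simp
  have sub: "I \<subseteq> dcarrier D" using I by (simp add: dba_ideal_def)
  have ne: "{y \<in> dcarrier D. x \<sqsubseteq> y} \<noteq> {}" using mem by blast
  show thesis
    by (rule primary_filter_extension[OF principal_filter[OF x(1,2)] ne sub I(2) down vee disj])
      (use that mem in blast)+
qed

text \<open>A filter of \<open>D\<close> is an ideal of the dual algebra, so this is
  \<open>primary_filter_separation\<close> there.\<close>

lemma primary_ideal_separation:
  assumes "dba_filter D F" "F \<noteq> {}" "x \<in> dcarrier D" "x \<squnion> x = x" "x \<notin> F"
  obtains I where "I \<in> primary_ideals D" "x \<in> I" "I \<inter> F = {}"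
proof -
  have "dba_ideal (dba_dual D) F"
    using assms(1) dle_dba_dual[OF double_boolean_algebra_axioms]
    by (fastforce simp: dba_filter_def dba_ideal_def)
  then show thesis
    using double_boolean_algebra.primary_filter_separation[OF dual_dba, of F x] assms that
    by (auto simp: primary_filters_dba_dual[OF double_boolean_algebra_axioms])
qed

section \<open>Primary filters as two-valued homomorphisms for meet and negation\<close>

lemma primary_filter_nonempty: "F \<in> primary_filters D \<Longrightarrow> F \<noteq> {}"
  using top_closed by (auto simp: primary_filters_def)

lemma primary_filter_bot: "F \<in> primary_filters D \<Longrightarrow> \<bottom> \<notin> F"
  using bot_le by (auto simp: primary_filters_def dba_filter_def)

lemma primary_filter_top: "F \<in> primary_filters D \<Longrightarrow> \<top> \<in> F"
  using primary_filter_bot neg_top top_closed by (force simp: primary_filters_def)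

lemma primary_filter_meet:
  assumes "F \<in> primary_filters D" "x \<in> dcarrier D" "y \<in> dcarrier D"
  shows "x \<sqinter> y \<in> F \<longleftrightarrow> x \<in> F \<and> y \<in> F"
  using assms meet_le1[of x y] meet_le2[of x y] by (auto simp: primary_filters_def dba_filter_def)

lemma primary_filter_neg:
  assumes "F \<in> primary_filters D" "x \<in> dcarrier D"
  shows "\<sim> x \<in> F \<longleftrightarrow> x \<notin> F"
  using assms primary_filter_meet[of F x "\<sim> x"] primary_filter_bot[of F]
  by (auto simp: meet_neg primary_filters_def)

lemma primary_filters_at_top: "primary_filters_at D \<top> = primary_filters D"
  using primary_filter_top by (auto simp: primary_filters_at_def)

lemma primary_filters_at_bot: "primary_filters_at D \<bottom> = {}"
  using primary_filter_bot by (auto simp: primary_filters_at_def)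

lemma primary_filters_at_meet:
  "\<lbrakk>x \<in> dcarrier D; y \<in> dcarrier D\<rbrakk> \<Longrightarrow>
    primary_filters_at D (x \<sqinter> y) = primary_filters_at D x \<inter> primary_filters_at D y"
  using primary_filter_meet by (auto simp: primary_filters_at_def)

lemma primary_filters_at_neg:
  "x \<in> dcarrier D \<Longrightarrow> primary_filters_at D (\<sim> x) = primary_filters D - primary_filters_at D x"
  using primary_filter_neg by (auto simp: primary_filters_at_def)

lemma primary_filters_at_vee:
  "\<lbrakk>x \<in> dcarrier D; y \<in> dcarrier D\<rbrakk> \<Longrightarrow>
    primary_filters_at D (x \<curlyvee> y) = primary_filters_at D x \<union> primary_filters_at D y"
  by (auto simp: dvee_def primary_filters_at_neg primary_filters_at_meet)
    (auto simp: primary_filters_at_def)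

text \<open>Otherwise \<open>x \<sqinter> \<sim> y\<close> differs from \<open>\<bottom>\<close>,
  and its principal filter extends to a primary filter that contains \<open>x\<close> and omits
  \<open>y\<close>.\<close>

lemma primary_filters_at_subset_imp_meet_absorb:
  assumes x: "x \<in> dcarrier D" and y: "y \<in> dcarrier D"
    and sub: "primary_filters_at D x \<subseteq> primary_filters_at D y"
  shows "x \<sqinter> y = x \<sqinter> x"
proof (rule ccontr)
  assume "x \<sqinter> y \<noteq> x \<sqinter> x"
  then have ne: "x \<sqinter> \<sim> y \<noteq> \<bottom>" using meet_neg_eq_bot_imp_meet_absorb x y by blast
  let ?z = "x \<sqinter> \<sim> y"
  have z: "?z \<in> dcarrier D" "?z \<sqinter> ?z = ?z" using x y by (auto simp: meet_self_meet)
  have "\<not> ?z \<sqsubseteq> \<bottom>" using ne z bot_le[OF z(1)] by (auto simp: dle_def meet_comm bot_meet_self)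
  then obtain G where "G \<in> primary_filters D" "?z \<in> G"
    using primary_filter_avoiding_bot[OF principal_filter[OF z]] z le_refl by blast
  then show False using sub x y primary_filter_meet[of G x "\<sim> y"] primary_filter_neg[of G y]
    by (auto simp: primary_filters_at_def)
qed

text \<open>Both squares equal \<open>x \<sqinter> y\<close>. Primary filters see only the
  \<open>\<sqinter>\<close>-square of an element; its \<open>\<squnion>\<close>-square is left to
  the ideals.\<close>

lemma primary_filters_at_inject:
  assumes "x \<in> dcarrier D" "y \<in> dcarrier D" "primary_filters_at D x = primary_filters_at D y"
  shows "x \<sqinter> x = y \<sqinter> y"
  using assms primary_filters_at_subset_imp_meet_absorb[of x y]
    primary_filters_at_subset_imp_meet_absorb[of y x] by (simp add: meet_comm)

section \<open>Clopen sets of the space of primary filters\<close>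

abbreviation filter_topology :: "'a set topology"
  where "filter_topology \<equiv>
    closed_subbase_topology (primary_filters D) (primary_filters_at D ` dcarrier D)"

lemma closedin_primary_filters_at:
  "x \<in> dcarrier D \<Longrightarrow> closedin filter_topology (primary_filters_at D x)"
  by (simp add: closedin_closed_subbase_topology primary_filters_at_subset)

lemma openin_primary_filters_at:
  assumes "x \<in> dcarrier D"
  shows "openin filter_topology (primary_filters_at D x)"
proof -
  have "primary_filters_at D x = primary_filters D - primary_filters_at D (\<sim> x)"
    using assms primary_filters_at_subset[of D x] by (auto simp: primary_filters_at_neg)
  then show ?thesis
    using closedin_primary_filters_at[of "\<sim> x"] assms by (auto simp: closedin_def)
qed

text \<open>The subbasic closed sets are stable under complement by \<open>\<sim>\<close> and under
  finite intersection by \<open>\<sqinter>\<close>, so they form a base of the open sets.\<close>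

lemma openin_filter_topology_base:
  assumes A: "openin filter_topology A" and F: "F \<in> A"
  obtains x where "x \<in> dcarrier D" "F \<in> primary_filters_at D x" "primary_filters_at D x \<subseteq> A"
proof -
  let ?P = "\<lambda>U. \<exists>C\<in>primary_filters_at D ` dcarrier D. U = primary_filters D - C"
  obtain V where V: "(finite intersection_of ?P relative_to primary_filters D) V" "F \<in> V" "V \<subseteq> A"
    using A F unfolding openin_closed_subbase_topology union_of_def by auto
  then obtain \<U> where "finite \<U>" "\<U> \<subseteq> Collect ?P" "V = primary_filters D \<inter> \<Inter>\<U>"
    unfolding relative_to_def intersection_of_def by blast
  have "\<exists>x\<in>dcarrier D. primary_filters D \<inter> \<Inter>\<U> = primary_filters_at D x"
    using \<open>finite \<U>\<close> \<open>\<U> \<subseteq> Collect ?P\<close>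
  proof (induction \<U>)
    case empty
    then show ?case using primary_filters_at_top by auto
  next
    case (insert U \<U>)
    then obtain x y where xy: "x \<in> dcarrier D" "primary_filters D \<inter> \<Inter>\<U> = primary_filters_at D x"
      "y \<in> dcarrier D" "U = primary_filters D - primary_filters_at D y" by auto
    \<comment> \<open>Removing the basic set of \<open>y\<close> amounts to intersecting with that
      of \<open>\<sim> y\<close>.\<close>
    then have "primary_filters D \<inter> \<Inter>(insert U \<U>) = primary_filters_at D (x \<sqinter> \<sim> y)"
      by (auto simp: primary_filters_at_meet primary_filters_at_neg)
    moreover have "x \<sqinter> \<sim> y \<in> dcarrier D" using xy by simp
    ultimately show ?case by blast
  qed
  then show thesis using V \<open>V = _\<close> that by metis
qed

text \<open>The basic open sets inside \<open>A\<close> and inside its complement cover the space. If no two of them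
  did, the complements of the elements involved would lie in a common primary filter, which belongs
  to neither set.\<close>

lemma clopen_filter_topology:
  assumes op: "openin filter_topology A" and cl: "closedin filter_topology A"
  obtains x where "x \<in> dcarrier D" "A = primary_filters_at D x"
proof -
  let ?X = "primary_filters D"
  let ?\<phi> = "primary_filters_at D"
  have AX: "A \<subseteq> ?X" using op openin_subset by force
  have op': "openin filter_topology (?X - A)" using cl by (simp add: closedin_def)
  \<comment> \<open>The elements \<open>\<sim> y \<sqinter> \<sim> z\<close> describe what is left
    uncovered by a basic set inside \<open>A\<close> and one inside its complement. Hence
    \<open>\<bottom> \<in> ?Z\<close> means that some two such sets cover the space.\<close>
  let ?Z = "{w \<in> dcarrier D. \<exists>y\<in>dcarrier D. \<exists>z\<in>dcarrier D.
    ?\<phi> y \<subseteq> A \<and> ?\<phi> z \<subseteq> ?X - A \<and> \<sim> y \<sqinter> \<sim> z \<sqsubseteq> w}"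
  have memZ: "\<sim> y \<sqinter> \<sim> z \<in> ?Z"
    if "y \<in> dcarrier D" "z \<in> dcarrier D" "?\<phi> y \<subseteq> A" "?\<phi> z \<subseteq> ?X - A" for y z
  proof -
    have "\<sim> y \<sqinter> \<sim> z \<in> dcarrier D" using that by simp
    then show ?thesis using that le_refl[of "\<sim> y \<sqinter> \<sim> z"] by blast
  qed
  have Z: "dba_filter D ?Z"
    unfolding dba_filter_def
  proof (intro conjI ballI impI)
    fix v w assume "v \<in> ?Z" "w \<in> ?Z"
    then obtain a b c d where *: "v \<in> dcarrier D" "w \<in> dcarrier D"
      "a \<in> dcarrier D" "b \<in> dcarrier D" "c \<in> dcarrier D" "d \<in> dcarrier D"
      "?\<phi> a \<subseteq> A" "?\<phi> c \<subseteq> A" "?\<phi> b \<subseteq> ?X - A" "?\<phi> d \<subseteq> ?X - A"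
      "\<sim> a \<sqinter> \<sim> b \<sqsubseteq> v" "\<sim> c \<sqinter> \<sim> d \<sqsubseteq> w" by auto
    \<comment> \<open>The basic sets inside \<open>A\<close> are united by
      \<open>\<curlyvee>\<close>, and so are those inside the complement; De Morgan turns this into
      a meet of the two lower bounds.\<close>
    let ?u = "\<sim> (a \<curlyvee> c) \<sqinter> \<sim> (b \<curlyvee> d)"
    have u: "?u = (\<sim> a \<sqinter> \<sim> b) \<sqinter> (\<sim> c \<sqinter> \<sim> d)"
      using * by (simp add: dvee_def neg_neg meet_self_meet) (simp add: meet_ac)
    have "?u \<sqsubseteq> \<sim> a \<sqinter> \<sim> b" "?u \<sqsubseteq> \<sim> c \<sqinter> \<sim> d"
      unfolding u using * by (auto intro!: meet_le1 meet_le2)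
    then have "?u \<sqsubseteq> v" "?u \<sqsubseteq> w"
      using * le_trans[of ?u "\<sim> a \<sqinter> \<sim> b" v] le_trans[of ?u "\<sim> c \<sqinter> \<sim> d" w] by auto
    then have "?u \<sqsubseteq> v \<sqinter> w" using * by (intro le_meetI) (auto simp: meet_self_meet)
    moreover have "?\<phi> (a \<curlyvee> c) \<subseteq> A" "?\<phi> (b \<curlyvee> d) \<subseteq> ?X - A"
      using * by (auto simp: primary_filters_at_vee)
    moreover have "v \<sqinter> w \<in> dcarrier D" "a \<curlyvee> c \<in> dcarrier D" "b \<curlyvee> d \<in> dcarrier D"
      using * by simp_all
    ultimately show "v \<sqinter> w \<in> ?Z" by blast
  next
    fix v w assume "v \<in> ?Z" "w \<in> dcarrier D" "v \<sqsubseteq> w"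
    moreover from this obtain y z where *: "v \<in> dcarrier D" "y \<in> dcarrier D" "z \<in> dcarrier D"
      "?\<phi> y \<subseteq> A" "?\<phi> z \<subseteq> ?X - A" "\<sim> y \<sqinter> \<sim> z \<sqsubseteq> v" by auto
    ultimately have "\<sim> y \<sqinter> \<sim> z \<sqsubseteq> w" using le_trans[of "\<sim> y \<sqinter> \<sim> z" v w] by simp
    then show "w \<in> ?Z" using * \<open>w \<in> dcarrier D\<close> by blast
  qed auto
  have bot: "\<sim> \<bottom> \<sqinter> \<sim> \<bottom> \<in> ?Z" by (rule memZ) (auto simp: primary_filters_at_bot)
  have "\<bottom> \<in> ?Z"
  proof (rule ccontr)
    assume "\<bottom> \<notin> ?Z"
    then obtain G where G: "G \<in> ?X" "?Z \<subseteq> G"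
      using primary_filter_avoiding_bot[OF Z] bot by blast
    show False
    proof (cases "G \<in> A")
      case True
      then obtain y where y: "y \<in> dcarrier D" "G \<in> ?\<phi> y" "?\<phi> y \<subseteq> A"
        using openin_filter_topology_base[OF op] by blast
      \<comment> \<open>On the other side \<open>\<bottom>\<close> is chosen, whose basic set is
        empty; thus \<open>G\<close> contains both \<open>y\<close> and
        \<open>\<sim> y\<close>.\<close>
      then have "\<sim> y \<sqinter> \<sim> \<bottom> \<in> G" using subsetD[OF G(2) memZ[of y \<bottom>]] by (simp add: primary_filters_at_bot)
      then show False
        using y G by (simp add: primary_filter_meet primary_filter_neg primary_filters_at_def)
    next
      case False
      then obtain y where y: "y \<in> dcarrier D" "G \<in> ?\<phi> y" "?\<phi> y \<subseteq> ?X - A"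
        using openin_filter_topology_base[OF op', of G] G by blast
      then have "\<sim> \<bottom> \<sqinter> \<sim> y \<in> G" using subsetD[OF G(2) memZ[of \<bottom> y]] by (simp add: primary_filters_at_bot)
      then show False
        using y G by (simp add: primary_filter_meet primary_filter_neg primary_filters_at_def)
    qed
  qed
  then obtain y z where yz: "y \<in> dcarrier D" "z \<in> dcarrier D" "?\<phi> y \<subseteq> A" "?\<phi> z \<subseteq> ?X - A"
    "\<sim> y \<sqinter> \<sim> z \<sqsubseteq> \<bottom>" by blast
  \<comment> \<open>A member of \<open>A\<close> omits \<open>z\<close>, hence contains
    \<open>\<sim> z\<close>; since it cannot contain \<open>\<sim> y \<sqinter> \<sim> z\<close>, it
    contains \<open>y\<close>.\<close>
  have "A \<subseteq> ?\<phi> y"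
  proof
    fix F assume F: "F \<in> A"
    then have FX: "F \<in> ?X" using AX by blast
    have "\<sim> y \<sqinter> \<sim> z \<notin> F"
    proof
      assume "\<sim> y \<sqinter> \<sim> z \<in> F"
      then have "\<bottom> \<in> F"
        using FX yz(5) bot_closed unfolding primary_filters_def dba_filter_def by blast
      then show False using primary_filter_bot[OF FX] by simp
    qed
    moreover have "z \<notin> F" using F FX yz(4) by (auto simp: primary_filters_at_def)
    ultimately show "F \<in> ?\<phi> y"
      using FX yz by (simp add: primary_filter_meet primary_filter_neg primary_filters_at_def)
  qed
  then show thesis using yz that by blast
qed

text \<open>The complement is taken because \<open>\<sqinter>\<close> of object oriented
  semiconcepts unites first components, whereas \<open>primary_filters_at\<close> turns
  \<open>\<sqinter>\<close> into intersection.\<close>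

abbreviation (input) filter_extent :: "'a \<Rightarrow> 'a set set"
  where "filter_extent x \<equiv> primary_filters D - primary_filters_at D x"

lemma clopen_filter_extent:
  assumes "openin filter_topology A" "closedin filter_topology A"
  obtains x where "x \<in> dcarrier D" "A = filter_extent x"
proof -
  obtain y where "y \<in> dcarrier D" "A = primary_filters_at D y"
    using clopen_filter_topology assms by blast
  then have "A = filter_extent (\<sim> y)"
    using primary_filters_at_subset[of D y] by (auto simp: primary_filters_at_neg)
  then show thesis using \<open>y \<in> dcarrier D\<close> that[of "\<sim> y"] by simp
qed

section \<open>Primary ideals by duality\<close>

abbreviation ideal_topology :: "'a set topology"
  where "ideal_topology \<equiv>
    closed_subbase_topology (primary_ideals D) (primary_ideals_at D ` dcarrier D)"

lemmas duals = primary_filters_dba_dual[OF double_boolean_algebra_axioms]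
  primary_filters_at_dba_dual[OF double_boolean_algebra_axioms]

lemmas primary_ideals_at_top =
  double_boolean_algebra.primary_filters_at_bot[OF dual_dba, simplified, unfolded duals]

lemmas primary_ideals_at_bot =
  double_boolean_algebra.primary_filters_at_top[OF dual_dba, simplified, unfolded duals]

lemmas primary_ideals_at_join =
  double_boolean_algebra.primary_filters_at_meet[OF dual_dba, simplified, unfolded duals]

lemmas primary_ideals_at_opp =
  double_boolean_algebra.primary_filters_at_neg[OF dual_dba, simplified, unfolded duals]

lemmas primary_ideals_at_inject =
  double_boolean_algebra.primary_filters_at_inject[OF dual_dba, simplified, unfolded duals]

lemmas primary_ideal_nonempty =
  double_boolean_algebra.primary_filter_nonempty[OF dual_dba, simplified, unfolded duals]

lemmas closedin_primary_ideals_at =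
  double_boolean_algebra.closedin_primary_filters_at[OF dual_dba, simplified, unfolded duals]

lemmas openin_primary_ideals_at =
  double_boolean_algebra.openin_primary_filters_at[OF dual_dba, simplified, unfolded duals]

lemmas clopen_ideal_topology =
  double_boolean_algebra.clopen_filter_topology[OF dual_dba, simplified, unfolded duals]

lemmas join_self_opp = double_boolean_algebra.meet_self_neg[OF dual_dba, simplified]

lemmas join_self_join = double_boolean_algebra.meet_self_meet[OF dual_dba, simplified]

section \<open>Box and diamond of the basic sets\<close>

abbreviation (input) disjointness :: "('a set \<times> 'a set) set"
  where "disjointness \<equiv> incidence (primary_context D)"

text \<open>A primary ideal \<open>I\<close> lies in the box when every primary filter disjoint from
  it omits \<open>x\<close>. This is clear for \<open>x \<in> I\<close>; for
  \<open>x \<notin> I\<close> separation yields a disjoint primary filter through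
  \<open>x\<close>.\<close>

lemma oo_box_filter_extent:
  assumes "x \<in> dcarrier D" "x \<sqinter> x = x"
  shows "oo_box (primary_ideals D) disjointness (filter_extent x) = primary_ideals_at D x"
proof -
  have "x \<in> I"
    if I: "I \<in> primary_ideals D" and
      *: "\<And>F. \<lbrakk>F \<in> primary_filters D; F \<inter> I = {}\<rbrakk> \<Longrightarrow> x \<notin> F" for I
    using primary_filter_separation[of I x] assms * primary_ideal_nonempty[OF I] I
    by (auto simp: primary_ideals_def)
  then show ?thesis
    by (fastforce simp: oo_box_def primary_context_def primary_ideals_at_def primary_filters_at_def)
qed

text \<open>A primary filter omitting \<open>x\<close> is separated from \<open>x\<close> by a
  primary ideal, which witnesses the diamond; a filter containing \<open>x\<close> meets every ideal
  containing \<open>x\<close>.\<close>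

lemma oo_diamond_primary_ideals_at:
  assumes "x \<in> dcarrier D" "x \<squnion> x = x"
  shows "oo_diamond (primary_filters D) disjointness (primary_ideals_at D x) = filter_extent x"
proof -
  have "\<exists>I\<in>primary_ideals D. x \<in> I \<and> F \<inter> I = {}"
    if F: "F \<in> primary_filters D" and *: "x \<notin> F" for F
  proof -
    have "dba_filter D F" using F by (simp add: primary_filters_def)
    then obtain I where "I \<in> primary_ideals D" "x \<in> I" "I \<inter> F = {}"
      using primary_ideal_separation primary_filter_nonempty[OF F] assms * by blast
    then show ?thesis by blast
  qed
  then show ?thesis
    by (fastforce simp: oo_diamond_def primary_context_def primary_ideals_at_def primary_filters_at_def)
qed

end

section \<open>The isomorphism\<close>

lemma (in pure_double_boolean_algebra) pure_eqI:
  assumes "x \<in> dcarrier D" "y \<in> dcarrier D" "x \<sqinter> x = y \<sqinter> y" "x \<squnion> x = y \<squnion> y"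
  shows "x = y"
  \<comment> \<open>The mixed case, say \<open>x \<sqinter> x = x\<close> and
    \<open>y \<squnion> y = y\<close>, rests on \<open>meet_join_self\<close> for \<open>y\<close>:
    its left side is \<open>x \<squnion> x = y\<close> and its right side is
    \<open>y \<sqinter> y = x\<close>.\<close>
  using pure[of x] pure[of y] meet_join_self[of x] meet_join_self[of y] assms by metis

theorem mainTheorem3:
  fixes D :: "'a dba"
  assumes "pure_double_boolean_algebra D"
  shows "dba_isomorphic D (clopen_oo_semiconcept_algebra (primary_context D))"
proof -
  interpret pure_double_boolean_algebra D by (rule assms)
  let ?G = "primary_filters D" and ?M = "primary_ideals D"
  let ?R = "incidence (primary_context D)"
  let ?E = "clopen_oo_semiconcept_algebra (primary_context D)"
  define h where "h x = (filter_extent x, primary_ideals_at D x)" for x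
  have obj: "objects (primary_context D) = filter_topology"
    and att: "attributes (primary_context D) = ideal_topology"
    by (simp_all add: primary_context_def)
  have carrier: "dcarrier ?E = {(A, B). (A, B) \<in> oo_semiconcepts ?G ?M ?R \<and>
      openin filter_topology A \<and> closedin filter_topology A \<and>
      openin ideal_topology B \<and> closedin ideal_topology B}"
    by (simp add: clopen_oo_semiconcept_algebra_def obj att Let_def)
  have ops: "djoin ?E = (\<lambda>(A, B) (C, D). (oo_diamond ?G ?R (B \<inter> D), B \<inter> D))"
    "dmeet ?E = (\<lambda>(A, B) (C, D). (A \<union> C, oo_box ?M ?R (A \<union> C)))"
    "dneg ?E = (\<lambda>(A, B). (?G - A, oo_box ?M ?R (?G - A)))"
    "dopp ?E = (\<lambda>(A, B). (oo_diamond ?G ?R (?M - B), ?M - B))"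
    "dtop ?E = ({}, {})" "dbot ?E = (?G, ?M)"
    by (simp_all add: clopen_oo_semiconcept_algebra_def obj att Let_def)
  \<comment> \<open>Each binary or unary operation of \<open>?E\<close> computes one component and
    derives the other by box or diamond. These two facts reduce a homomorphism equation to the
    computed component.\<close>
  have h_box: "h x = (A, oo_box ?M ?R A)"
    if "x \<in> dcarrier D" "x \<sqinter>\<^bsub>D\<^esub> x = x" "filter_extent x = A" for x A
    using that oo_box_filter_extent by (auto simp: h_def)
  have h_diamond: "h x = (oo_diamond ?G ?R B, B)"
    if "x \<in> dcarrier D" "x \<squnion>\<^bsub>D\<^esub> x = x" "primary_ideals_at D x = B" for x B
    using that oo_diamond_primary_ideals_at by (auto simp: h_def)
  have "inj_on h (dcarrier D)"
  proof (rule inj_onI)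
    fix x y assume xy: "x \<in> dcarrier D" "y \<in> dcarrier D" "h x = h y"
    then have "primary_filters_at D x = primary_filters_at D y"
      "primary_ideals_at D x = primary_ideals_at D y"
      using primary_filters_at_subset[of D x] primary_filters_at_subset[of D y]
      by (auto simp: h_def)
    \<comment> \<open>The filters determine the \<open>\<sqinter>\<close>-square, the ideals the
      \<open>\<squnion>\<close>-square, and purity recovers the element from the two.\<close>
    then show "x = y" using xy pure_eqI primary_filters_at_inject primary_ideals_at_inject by metis
  qed
  moreover have "h ` dcarrier D = dcarrier ?E"
  proof (intro equalityI subsetI)
    fix p assume "p \<in> h ` dcarrier D"
    then obtain x where x: "x \<in> dcarrier D" "p = h x" by blast
    have "oo_box ?M ?R (filter_extent x) = primary_ideals_at D x \<or>
      oo_diamond ?G ?R (primary_ideals_at D x) = filter_extent x"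
      using pure[of x] x oo_box_filter_extent oo_diamond_primary_ideals_at by blast
    then have "h x \<in> oo_semiconcepts ?G ?M ?R"
      by (auto simp: h_def oo_semiconcepts_def primary_ideals_at_def)
    \<comment> \<open>The extent of \<open>x\<close> is the basic set of \<open>\<sim> x\<close>,
      hence clopen.\<close>
    then show "p \<in> dcarrier ?E"
      using x closedin_primary_filters_at[of "\<sim>\<^bsub>D\<^esub> x"] openin_primary_filters_at[of "\<sim>\<^bsub>D\<^esub> x"]
        closedin_primary_ideals_at[of x] openin_primary_ideals_at[of x]
      by (simp add: carrier h_def primary_filters_at_neg)
  next
    fix p assume "p \<in> dcarrier ?E"
    then obtain A B where p: "p = (A, B)" "(A, B) \<in> oo_semiconcepts ?G ?M ?R"
      "openin filter_topology A" "closedin filter_topology A"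
      "openin ideal_topology B" "closedin ideal_topology B" by (auto simp: carrier)
    then consider "oo_box ?M ?R A = B" | "oo_diamond ?G ?R B = A"
      by (auto simp: oo_semiconcepts_def)
    then show "p \<in> h ` dcarrier D"
    proof cases
      case 1
      obtain x where x: "x \<in> dcarrier D" "A = filter_extent x"
        using clopen_filter_extent p by blast
      \<comment> \<open>Passing to the square keeps the extent and gives a
        \<open>\<sqinter>\<close>-idempotent, so the second component is the box of
        \<open>A\<close>, which is \<open>B\<close>.\<close>
      then have "h (x \<sqinter>\<^bsub>D\<^esub> x) = p"
        using 1 p h_box[of "x \<sqinter>\<^bsub>D\<^esub> x" A] by (simp add: meet_self_meet primary_filters_at_meet)
      then show ?thesis using x by (metis imageI meet_closed)
    next
      case 2
      obtain x where x: "x \<in> dcarrier D" "B = primary_ideals_at D x"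
        using clopen_ideal_topology p by blast
      then have "h (x \<squnion>\<^bsub>D\<^esub> x) = p"
        using 2 p h_diamond[of "x \<squnion>\<^bsub>D\<^esub> x" B] by (simp add: join_self_join primary_ideals_at_join)
      then show ?thesis using x by (metis imageI join_closed)
    qed
  qed
  \<comment> \<open>Values of \<open>\<squnion>\<close> and \<open>\<ominus>\<close> are
    \<open>\<squnion>\<close>-idempotent, so \<open>h_diamond\<close> applies to them; values of
    \<open>\<sqinter>\<close> and \<open>\<sim>\<close> are \<open>\<sqinter>\<close>-idempotent and
    fall under \<open>h_box\<close>.\<close>
  moreover have "h (x \<squnion>\<^bsub>D\<^esub> y) = h x \<squnion>\<^bsub>?E\<^esub> h y" if "x \<in> dcarrier D" "y \<in> dcarrier D" for x y
    using h_diamond[of "x \<squnion>\<^bsub>D\<^esub> y"] that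
    by (simp add: ops join_self_join primary_ideals_at_join) (simp add: h_def)
  moreover have "h (x \<sqinter>\<^bsub>D\<^esub> y) = h x \<sqinter>\<^bsub>?E\<^esub> h y" if "x \<in> dcarrier D" "y \<in> dcarrier D" for x y
    using h_box[of "x \<sqinter>\<^bsub>D\<^esub> y"] that
    by (simp add: ops meet_self_meet primary_filters_at_meet) (simp add: h_def Diff_Int)
  moreover have "h (\<sim>\<^bsub>D\<^esub> x) = \<sim>\<^bsub>?E\<^esub> (h x)" if "x \<in> dcarrier D" for x
    using h_box[of "\<sim>\<^bsub>D\<^esub> x"] that
    by (simp add: ops meet_self_neg primary_filters_at_neg) (simp add: h_def)
  moreover have "h (\<ominus>\<^bsub>D\<^esub> x) = \<ominus>\<^bsub>?E\<^esub> (h x)" if "x \<in> dcarrier D" for x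
    using h_diamond[of "\<ominus>\<^bsub>D\<^esub> x"] that
    by (simp add: ops join_self_opp primary_ideals_at_opp) (simp add: h_def)
  moreover have "h \<top>\<^bsub>D\<^esub> = \<top>\<^bsub>?E\<^esub>"
    by (simp add: h_def ops primary_filters_at_top primary_ideals_at_top)
  moreover have "h \<bottom>\<^bsub>D\<^esub> = \<bottom>\<^bsub>?E\<^esub>"
    by (simp add: h_def ops primary_filters_at_bot primary_ideals_at_bot)
  ultimately have "dba_iso D ?E h" by (simp add: dba_iso_def bij_betw_def)
  then show ?thesis by (auto simp: dba_isomorphic_def)
qed

end
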